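(* Let $d\ge 1$ be an integer, let $F\subset\mathbb Z_+^d$ be a finite set of multi-indices, and let $\{\beta_{\mathbf i}\}_{\mathbf i\in F}$ be any finite multi-index sequence of real numbers. Then the sequence has an interpolating measure; that is, there exists a (not necessarily positive) Borel measure $\mu$ on $\mathbb R^d$ such that $$\beta_{\mathbf i}=\int_{\mathbb R^d}\mathbf x^{\mathbf i}\,d\mu(\mathbf x)\qquad\text{for all }\mathbf i\in F .$$
   Context: $\mathbb Z_+$ denotes the nonnegative integers. For $\mathbf i=(i_1,\dots,i_d)\in\mathbb Z_+^d$ and $\mathbf x=(x_1,\dots,x_d)\in\mathbb R^d$, $\mathbf x^{\mathbf i}=x_1^{i_1}\cdots x_d^{i_d}$. An interpolating measure for a real multi-index sequence is a signed (i.e. not necessarily positive) Borel measure $\mu$ on $\mathbb R^d$, with respect to which all the monomials $\mathbf x^{\mathbf i}$ involved are integrable, such that $\beta_{\mathbf i}=\int\mathbf x^{\mathbf i}\,d\mu$ for all $\mathbf i$ in the index set. No condition is imposed on $\beta_{\mathbf 0}$ (it may be zero). *)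

theory Defs
  imports "HOL-Analysis.Analysis"
begin

(* Extended-real-valued signed measures, attaining at most one of the two infinite values.
   The series condition includes convergence; since the union does not depend on the order
   of the sets, convergence is automatically unconditional. *)
definition signed_measure :: "'a measure \<Rightarrow> ('a set \<Rightarrow> ereal) \<Rightarrow> bool" where
  "signed_measure M \<mu> \<longleftrightarrow>
     \<mu> {} = 0 \<and>
     ((\<forall>A\<in>sets M. \<mu> A \<noteq> \<infinity>) \<or> (\<forall>A\<in>sets M. \<mu> A \<noteq> -\<infinity>)) \<and>
     (\<forall>A :: nat \<Rightarrow> 'a set. range A \<subseteq> sets M \<longrightarrow> disjoint_family A \<longrightarrow>
        (\<lambda>n. \<mu> (A n)) sums \<mu> (\<Union>n. A n))"

(* The two parts of the Jordan decomposition, given by the usual supremum formula;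
   e2ennreal maps negative values to 0, which does not affect the supremum because of B = {}.
   That the supremum really is countably additive, so that measure_of does not fall back
   to the zero measure, is emeasure_pos_variation and emeasure_neg_variation below. *)
definition pos_variation :: "'a measure \<Rightarrow> ('a set \<Rightarrow> ereal) \<Rightarrow> 'a measure" where
  "pos_variation M \<mu> =
     measure_of (space M) (sets M) (\<lambda>A. SUP B\<in>{B \<in> sets M. B \<subseteq> A}. e2ennreal (\<mu> B))"

definition neg_variation :: "'a measure \<Rightarrow> ('a set \<Rightarrow> ereal) \<Rightarrow> 'a measure" where
  "neg_variation M \<mu> = pos_variation M (\<lambda>A. - \<mu> A)"

(* Equivalent to integrability with respect to the total variation,
   which is the sum of the two variations. *)
definition signed_integrable ::
    "'a measure \<Rightarrow> ('a set \<Rightarrow> ereal) \<Rightarrow> ('a \<Rightarrow> real) \<Rightarrow> bool" where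
  "signed_integrable M \<mu> f \<longleftrightarrow>
     integrable (pos_variation M \<mu>) f \<and> integrable (neg_variation M \<mu>) f"

definition signed_integral ::
    "'a measure \<Rightarrow> ('a set \<Rightarrow> ereal) \<Rightarrow> ('a \<Rightarrow> real) \<Rightarrow> real" where
  "signed_integral M \<mu> f =
     integral\<^sup>L (pos_variation M \<mu>) f - integral\<^sup>L (neg_variation M \<mu>) f"

definition monomial :: "nat ^ 'd::finite \<Rightarrow> real ^ 'd \<Rightarrow> real" where
  "monomial i x = (\<Prod>k\<in>UNIV. (x $ k) ^ (i $ k))"

(* Only the values of \<beta> on F matter. *)
definition interpolating_measure ::
    "(nat ^ 'd::finite) set \<Rightarrow> (nat ^ 'd \<Rightarrow> real) \<Rightarrow> ((real ^ 'd) set \<Rightarrow> ereal) \<Rightarrow> bool" where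
  "interpolating_measure F \<beta> \<mu> \<longleftrightarrow>
     signed_measure borel \<mu> \<and>
     (\<forall>i\<in>F. signed_integrable borel \<mu> (monomial i)) \<and>
     (\<forall>i\<in>F. \<beta> i = signed_integral borel \<mu> (monomial i))"

lemma sets_pos_variation [simp]: "sets (pos_variation M \<mu>) = sets M"
  and space_pos_variation [simp]: "space (pos_variation M \<mu>) = space M"
  by (simp_all add: pos_variation_def)

lemma sets_neg_variation [simp]: "sets (neg_variation M \<mu>) = sets M"
  and space_neg_variation [simp]: "space (neg_variation M \<mu>) = space M"
  by (simp_all add: neg_variation_def)

lemma signed_measure_Un:
  assumes "signed_measure M \<mu>" "A \<in> sets M" "B \<in> sets M" "A \<inter> B = {}"
  shows "\<mu> (A \<union> B) = \<mu> A + \<mu> B"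
proof -
  let ?C = "\<lambda>n::nat. if n = 0 then A else if n = 1 then B else {}"
  have "disjoint_family ?C" "range ?C \<subseteq> sets M"
    using assms by (auto simp: disjoint_family_on_def)
  then have "(\<lambda>n. \<mu> (?C n)) sums \<mu> (\<Union>n. ?C n)"
    using assms(1) unfolding signed_measure_def by blast
  moreover have "(\<Union>n. ?C n) = A \<union> B"
    by (auto split: if_splits)
  ultimately have "(\<lambda>n. \<mu> (?C n)) sums \<mu> (A \<union> B)"
    by (simp only:)
  moreover have "(\<lambda>n. \<mu> (?C n)) sums (\<Sum>n\<in>{0,1}. \<mu> (?C n))"
    by (rule sums_finite) (use assms(1) in \<open>simp_all add: signed_measure_def\<close>)
  ultimately have "\<mu> (A \<union> B) = (\<Sum>n\<in>{0,1}. \<mu> (?C n))"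
    by (rule sums_unique2)
  then show ?thesis
    by simp
qed

lemma signed_measure_uminus:
  assumes "signed_measure M \<mu>"
  shows "signed_measure M (\<lambda>A. - \<mu> A)"
proof -
  have "(\<lambda>n. - \<mu> (A n)) sums - \<mu> (\<Union>n. A n)"
    if A: "range A \<subseteq> sets M" "disjoint_family A" for A :: "nat \<Rightarrow> 'a set"
  proof -
    have s: "(\<lambda>n. \<mu> (A n)) sums \<mu> (\<Union>n. A n)"
      using assms A unfolding signed_measure_def by blast
    have fin: "(\<forall>n. \<mu> (A n) \<noteq> \<infinity>) \<or> (\<forall>n. \<mu> (A n) \<noteq> -\<infinity>)"
      using assms A unfolding signed_measure_def by blast
    have "(\<Sum>i<n. - \<mu> (A i)) = - (\<Sum>i<n. \<mu> (A i))" for n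
    proof (induction n)
      case (Suc n)
      have "(\<Sum>i<n. \<mu> (A i)) \<noteq> -\<infinity>" if "\<forall>n. \<mu> (A n) \<noteq> -\<infinity>" for n
        using that by (induction n) auto
      then have "\<mu> (A n) \<noteq> \<infinity> \<and> (\<Sum>i<n. \<mu> (A i)) \<noteq> \<infinity> \<or>
            \<mu> (A n) \<noteq> -\<infinity> \<and> (\<Sum>i<n. \<mu> (A i)) \<noteq> -\<infinity>"
        using fin by (auto simp: sum_Pinfty)
      with Suc show ?case
        by (cases "\<mu> (A n)"; cases "\<Sum>i<n. \<mu> (A i)") auto
    qed simp
    then show ?thesis
      using s unfolding sums_def by (simp add: tendsto_uminus_ereal)
  qed
  then show ?thesis
    using assms unfolding signed_measure_def by (auto simp: ereal_uminus_eq_reorder)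
qed

lemma e2ennreal_add_le: "e2ennreal (x + y) \<le> e2ennreal x + e2ennreal y"
proof (cases "x \<ge> 0 \<and> y \<ge> 0")
  case True
  then show ?thesis by (cases x; cases y) auto
next
  case False
  then have "x + y \<le> y \<or> x + y \<le> x"
    by (cases x; cases y) auto
  then have "e2ennreal (x + y) \<le> e2ennreal y \<or> e2ennreal (x + y) \<le> e2ennreal x"
    by (auto intro: e2ennreal_mono)
  then show ?thesis
    by (metis add_increasing add_increasing2 zero_le)
qed

lemma emeasure_pos_variation:
  assumes \<mu>: "signed_measure M \<mu>" and A: "A \<in> sets M"
  shows "emeasure (pos_variation M \<mu>) A = (SUP B\<in>{B \<in> sets M. B \<subseteq> A}. e2ennreal (\<mu> B))"
proof -
  define \<phi> where "\<phi> A = (SUP B\<in>{B \<in> sets M. B \<subseteq> A}. e2ennreal (\<mu> B))" for A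
  have upper: "e2ennreal (\<mu> B) \<le> \<phi> A" if "B \<in> sets M" "B \<subseteq> A" for A B
    unfolding \<phi>_def using that by (auto intro: SUP_upper)
  have mono: "\<phi> A \<le> \<phi> B" if "A \<subseteq> B" for A B
    unfolding \<phi>_def using that by (intro SUP_subset_mono) auto
  have empty: "\<mu> {} = 0" using \<mu> by (simp add: signed_measure_def)
  have superadd: "\<phi> A + \<phi> B \<le> \<phi> (A \<union> B)" if disj: "A \<inter> B = {}" for A B
  proof -
    have "e2ennreal (\<mu> C) + e2ennreal (\<mu> D) \<le> \<phi> (A \<union> B)"
      if C: "C \<in> sets M" "C \<subseteq> A" and D: "D \<in> sets M" "D \<subseteq> B" for C D
    proof (cases "\<mu> C \<ge> 0 \<and> \<mu> D \<ge> 0")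
      case True
      have "\<mu> (C \<union> D) = \<mu> C + \<mu> D"
        using C D disj by (intro signed_measure_Un[OF \<mu>]) auto
      moreover have "e2ennreal (\<mu> C + \<mu> D) = e2ennreal (\<mu> C) + e2ennreal (\<mu> D)"
        using True by (cases "\<mu> C"; cases "\<mu> D") auto
      moreover have "e2ennreal (\<mu> (C \<union> D)) \<le> \<phi> (A \<union> B)"
        using C D by (intro upper) auto
      ultimately show ?thesis by simp
    next
      case False
      moreover have "e2ennreal (\<mu> C) \<le> \<phi> (A \<union> B)" "e2ennreal (\<mu> D) \<le> \<phi> (A \<union> B)"
        using C D by (auto intro!: upper)
      ultimately show ?thesis by (auto simp: e2ennreal_neg)
    qed
    then have "\<phi> A + e2ennreal (\<mu> D) \<le> \<phi> (A \<union> B)" if "D \<in> sets M" "D \<subseteq> B" for D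
      using that unfolding \<phi>_def[of A]
      by (subst ennreal_SUP_add_left[symmetric]) (auto intro!: SUP_least)
    then show ?thesis
      unfolding \<phi>_def[of B]
      by (subst ennreal_SUP_add_right) (auto intro!: SUP_least)
  qed
  have ca: "countably_additive (sets M) \<phi>"
  proof (rule countably_additiveI, rule antisym)
    fix A :: "nat \<Rightarrow> 'a set"
    assume A: "range A \<subseteq> sets M" "disjoint_family A" "(\<Union>n. A n) \<in> sets M"
    have "(\<Sum>i<n. \<phi> (A i)) \<le> \<phi> (\<Union>i<n. A i)" for n
    proof (induction n)
      case (Suc n)
      have "(\<Union>i<n. A i) \<inter> A n = {}"
      proof -
        have "A i \<inter> A n = {}" if "i < n" for i
          using disjoint_family_onD[OF A(2), of i n] that by simp
        then show ?thesis by blast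
      qed
      have "(\<Sum>i<Suc n. \<phi> (A i)) \<le> \<phi> (\<Union>i<n. A i) + \<phi> (A n)"
        using Suc by (simp add: add_right_mono)
      also have "\<dots> \<le> \<phi> ((\<Union>i<n. A i) \<union> A n)"
        by (rule superadd) fact
      also have "(\<Union>i<n. A i) \<union> A n = (\<Union>i<Suc n. A i)"
        by (auto simp: lessThan_Suc)
      finally show ?case .
    qed simp
    moreover have "\<phi> (\<Union>i<n. A i) \<le> \<phi> (\<Union>i. A i)" for n
      by (rule mono) auto
    ultimately have "(\<Sum>i<n. \<phi> (A i)) \<le> \<phi> (\<Union>i. A i)" for n
      using order_trans by blast
    then show "(\<Sum>i. \<phi> (A i)) \<le> \<phi> (\<Union>i. A i)"
      by (rule suminf_le_const[OF summableI])
  next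
    fix A :: "nat \<Rightarrow> 'a set"
    assume A: "range A \<subseteq> sets M" "disjoint_family A" "(\<Union>n. A n) \<in> sets M"
    have "e2ennreal (\<mu> B) \<le> (\<Sum>i. \<phi> (A i))" if B: "B \<in> sets M" "B \<subseteq> (\<Union>n. A n)" for B
    proof (rule LIMSEQ_le_const2)
      have "range (\<lambda>n. B \<inter> A n) \<subseteq> sets M" "disjoint_family (\<lambda>n. B \<inter> A n)"
        using A B by (auto simp: disjoint_family_on_def)
      then have "(\<lambda>n. \<mu> (B \<inter> A n)) sums \<mu> (\<Union>n. B \<inter> A n)"
        using \<mu> unfolding signed_measure_def by blast
      moreover have "(\<Union>n. B \<inter> A n) = B" using B by auto
      ultimately show "(\<lambda>n. e2ennreal (\<Sum>i<n. \<mu> (B \<inter> A i))) \<longlonglongrightarrow> e2ennreal (\<mu> B)"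
        unfolding sums_def by (auto intro: tendsto_e2ennrealI)
      have "e2ennreal (\<Sum>i<n. \<mu> (B \<inter> A i)) \<le> (\<Sum>i<n. \<phi> (A i))" for n
      proof (induction n)
        case (Suc n)
        have "e2ennreal (\<mu> (B \<inter> A n)) \<le> \<phi> (A n)"
          using A B by (intro upper) auto
        with Suc have "e2ennreal (\<Sum>i<n. \<mu> (B \<inter> A i)) + e2ennreal (\<mu> (B \<inter> A n))
            \<le> (\<Sum>i<n. \<phi> (A i)) + \<phi> (A n)"
          by (intro add_mono)
        then show ?case
          using order_trans[OF e2ennreal_add_le] by simp
      qed (simp add: e2ennreal_neg)
      moreover have "(\<Sum>i<n. \<phi> (A i)) \<le> (\<Sum>i. \<phi> (A i))" for n
        by (rule sum_le_suminf) (auto simp: summableI)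
      ultimately have "e2ennreal (\<Sum>i<n. \<mu> (B \<inter> A i)) \<le> (\<Sum>i. \<phi> (A i))" for n
        using order_trans by blast
      then show "\<exists>N. \<forall>n\<ge>N. e2ennreal (\<Sum>i<n. \<mu> (B \<inter> A i)) \<le> (\<Sum>i. \<phi> (A i))"
        by auto
    qed
    then show "\<phi> (\<Union>i. A i) \<le> (\<Sum>i. \<phi> (A i))"
      unfolding \<phi>_def[of "\<Union>i. A i"] by (auto intro!: SUP_least)
  qed
  have "\<phi> {} = 0"
    by (auto simp: \<phi>_def empty e2ennreal_neg)
  then have "positive (sets M) \<phi>"
    by (simp add: positive_def)
  then have "emeasure (measure_of (space M) (sets M) \<phi>) A = \<phi> A"
    using ca A by (intro emeasure_measure_of_sigma) (auto simp: sets.sigma_algebra_axioms)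
  then show ?thesis
    unfolding pos_variation_def \<phi>_def .
qed

lemma emeasure_neg_variation:
  assumes "signed_measure M \<mu>" "A \<in> sets M"
  shows "emeasure (neg_variation M \<mu>) A = (SUP B\<in>{B \<in> sets M. B \<subseteq> A}. e2ennreal (- \<mu> B))"
  unfolding neg_variation_def
  by (rule emeasure_pos_variation[OF signed_measure_uminus[OF assms(1)] assms(2)])

end

theory Submission
  imports Defs "HOL-Computational_Algebra.Polynomial" "HOL-Computational_Algebra.Primes"
begin

text \<open>
  Finitely many point masses suffice. Give the coordinates of a point \<open>y\<close> pairwise distinct prime
  values. By unique factorization the monomials take pairwise distinct values \<open>m i\<close> at \<open>y\<close>,
  and at the coordinatewise powers of \<open>y\<close> they take the values \<open>(m i) ^ n\<close>. Asking for weights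
  \<open>c n\<close> at these points with \<open>(\<Sum>n. c n * (m i) ^ n) = \<beta> i\<close> for \<open>i \<in> F\<close> is asking for the
  coefficients of a polynomial in one variable with prescribed values at the distinct nodes
  \<open>m i\<close>, and such a polynomial exists (\<open>ex_finite_interpolating_weights\<close>).

  Turning weights into a measure requires the two variations of a finite combination of point
  masses: they are the combinations with the positive and the negative parts of the weights,
  because the supremum in the definition of the positive variation is attained at the set of the
  atoms of positive weight (\<open>pos_variation_atomic\<close>). Every measurable function is then integrable,
  and its integral is the weighted sum of its values (\<open>signed_integral_atomic\<close>).
\<close>

lemma ex_poly_interpolating:
  fixes m b :: "'i \<Rightarrow> 'a::field"
  assumes "finite F" "inj_on m F"
  shows "\<exists>P. \<forall>i\<in>F. poly P (m i) = b i"
  using assms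
proof (induction F)
  case (insert a F)
  then obtain P where P: "\<And>i. i \<in> F \<Longrightarrow> poly P (m i) = b i"
    by (auto simp: inj_on_insert)
  \<comment> \<open>Newton's form: a multiple of \<open>Q\<close> corrects the value at the new node without changing it at
      the old ones.\<close>
  define Q where "Q = (\<Prod>j\<in>F. [:- m j, 1:])"
  have zero: "poly Q (m i) = 0" if "i \<in> F" for i
    using that insert.hyps by (auto simp: Q_def poly_prod)
  have nonzero: "poly Q (m a) \<noteq> 0"
    using insert.hyps insert.prems by (auto simp: Q_def poly_prod inj_on_def)
  have "poly (P + smult ((b a - poly P (m a)) / poly Q (m a)) Q) (m i) = b i"
    if "i \<in> insert a F" for i
    using that P zero nonzero by auto
  then show ?case by blast
qed simp

text \<open>Distinct multi-indices are separated already by a single point: the exponents can be read off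
  as the multiplicities of the primes in the value of the monomial.\<close>

lemma inj_monomial_prime_point:
  fixes p :: "'d::finite \<Rightarrow> nat"
  assumes "\<And>k. prime (p k)" "inj p"
  shows "inj (\<lambda>i. monomial i (\<chi> k. real (p k)))"
proof (rule injI)
  fix i j :: "nat ^ 'd"
  assume "monomial i (\<chi> k. real (p k)) = monomial j (\<chi> k. real (p k))"
  then have "real (\<Prod>k\<in>UNIV. p k ^ (i $ k)) = real (\<Prod>k\<in>UNIV. p k ^ (j $ k))"
    by (simp add: monomial_def)
  then have eq: "(\<Prod>k\<in>UNIV. p k ^ (i $ k)) = (\<Prod>k\<in>UNIV. p k ^ (j $ k))"
    by (simp only: of_nat_eq_iff)
  have "multiplicity (p k) (\<Prod>k\<in>UNIV. p k ^ (i $ k)) = i $ k" for i :: "nat ^ 'd" and k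
  proof -
    have "(\<Prod>k\<in>UNIV. p k ^ (i $ k)) = (\<Prod>q\<in>range p. q ^ (i $ inv p q))"
      using assms(2) by (subst prod.reindex) auto
    then show ?thesis
      using assms
      by (simp only:, subst multiplicity_prod_prime_powers) auto
  qed
  then show "i = j"
    using eq by (metis vec_eq_iff)
qed

text \<open>The truncated moment problem becomes a Vandermonde system on the geometric progression of points
  \<open>y n\<close>, solved by the coefficients of an interpolating polynomial.\<close>

lemma ex_finite_interpolating_weights:
  fixes F :: "(nat ^ 'd::finite) set" and \<beta> :: "nat ^ 'd \<Rightarrow> real"
  assumes "finite F"
  shows "\<exists>S c. finite S \<and> (\<forall>i\<in>F. (\<Sum>x\<in>S. c x * monomial i x) = \<beta> i)"
proof -
  obtain f :: "'d \<Rightarrow> nat" where f: "inj f"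
    using finite_imp_inj_to_nat_seg[OF finite_class.finite_UNIV] by blast
  define p where "p = enumerate {q::nat. prime q} \<circ> f"
  have p: "prime (p k)" for k
    using enumerate_in_set[OF primes_infinite, of "f k"] by (simp add: p_def)
  have "inj p"
    unfolding p_def by (intro inj_compose f inj_enumerate primes_infinite)
  define y :: "nat \<Rightarrow> real ^ 'd" where "y = (\<lambda>n. \<chi> k. real (p k) ^ n)"
  have power: "monomial i (y n) = monomial i (\<chi> k. real (p k)) ^ n" for i n
    by (simp add: y_def monomial_def prod_power_distrib mult.commute flip: power_mult)
  obtain P where P: "\<And>i. i \<in> F \<Longrightarrow> poly P (monomial i (\<chi> k. real (p k))) = \<beta> i"
    using ex_poly_interpolating[OF assms inj_on_subset[OF inj_monomial_prime_point[OF p \<open>inj p\<close>]]]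
    by blast
  define S where "S = y ` {..degree P}"
  \<comment> \<open>The weights have to be a function of the point rather than of the index \<open>n\<close>, so the
      coefficients are added up over the fibres of \<open>y\<close>.\<close>
  define c where "c x = (\<Sum>n\<in>{n \<in> {..degree P}. y n = x}. coeff P n)" for x
  have "(\<Sum>x\<in>S. c x * monomial i x) = \<beta> i" if "i \<in> F" for i
  proof -
    have "(\<Sum>x\<in>S. c x * monomial i x)
        = (\<Sum>x\<in>S. \<Sum>n\<in>{n \<in> {..degree P}. y n = x}. coeff P n * monomial i (y n))"
      by (auto simp: c_def sum_distrib_right intro!: sum.cong)
    also have "\<dots> = (\<Sum>n\<le>degree P. coeff P n * monomial i (y n))"
      unfolding S_def by (rule sum.image_gen[symmetric]) simp
    also have "\<dots> = \<beta> i"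
      using P[OF that] by (simp add: power poly_altdef)
    finally show ?thesis .
  qed
  then show ?thesis
    unfolding S_def by blast
qed

definition atomic_signed_measure :: "'a set \<Rightarrow> ('a \<Rightarrow> real) \<Rightarrow> 'a set \<Rightarrow> ereal" where
  "atomic_signed_measure S c A = ereal (\<Sum>x\<in>S. c x * indicator A x)"

lemma signed_measure_atomic: "signed_measure M (atomic_signed_measure S c)"
proof -
  have "(\<lambda>n. atomic_signed_measure S c (A n)) sums atomic_signed_measure S c (\<Union>n. A n)"
    if "disjoint_family A" for A :: "nat \<Rightarrow> 'a set"
    unfolding atomic_signed_measure_def sums_ereal
    by (intro sums_sum sums_mult indicator_sums)
       (use that in \<open>auto simp: disjoint_family_on_def\<close>)
  then show ?thesis
    unfolding signed_measure_def by (auto simp: atomic_signed_measure_def)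
qed

text \<open>Presenting the variation as an image of a point measure reduces integration against it to
  finite sums; the image under the identity only replaces the power set of \<open>S\<close> by
  \<open>sets M\<close>.\<close>

lemma pos_variation_atomic:
  assumes "finite S" "S \<subseteq> space M" "\<And>x. x \<in> S \<Longrightarrow> {x} \<in> sets M"
  shows "pos_variation M (atomic_signed_measure S c)
       = distr (point_measure S (\<lambda>x. ennreal (max 0 (c x)))) M (\<lambda>x. x)"
    (is "_ = ?D")
proof (rule measure_eqI)
  fix A assume "A \<in> sets (pos_variation M (atomic_signed_measure S c))"
  then have A: "A \<in> sets M" by simp
  let ?T = "{x \<in> S \<inter> A. c x > 0}"
  have finite: "finite (S \<inter> A)" "finite ?T"
    using assms(1) by auto
  have atomic: "atomic_signed_measure S c B = ereal (sum c (S \<inter> B))" for B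
    using assms(1) by (simp add: atomic_signed_measure_def sum.inter_restrict indicator_def if_distrib cong: if_cong)
  have "?T = (\<Union>x\<in>?T. {x})" by blast
  also have "\<dots> \<in> sets M"
    using finite assms(3) by (intro sets.finite_UN) auto
  finally have T: "?T \<in> sets M" .
  have positive: "sum c ?T = (\<Sum>x\<in>S \<inter> A. max 0 (c x))"
    using finite by (intro sum.mono_neutral_cong_left) auto
  \<comment> \<open>No set can collect more mass than the atoms of positive weight together.\<close>
  have bound: "sum c (S \<inter> B) \<le> sum c ?T" if "B \<subseteq> A" for B
  proof -
    have "sum c (S \<inter> B) \<le> (\<Sum>x\<in>S \<inter> B. max 0 (c x))"
      by (intro sum_mono) simp
    also have "\<dots> \<le> (\<Sum>x\<in>S \<inter> A. max 0 (c x))"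
      using finite that by (intro sum_mono2) auto
    finally show ?thesis by (simp only: positive)
  qed
  have "emeasure (pos_variation M (atomic_signed_measure S c)) A
      = (SUP B\<in>{B \<in> sets M. B \<subseteq> A}. ennreal (sum c (S \<inter> B)))"
    using A by (simp add: emeasure_pos_variation[OF signed_measure_atomic] atomic)
  also have "\<dots> = ennreal (sum c ?T)"
  proof (rule antisym)
    show "(SUP B\<in>{B \<in> sets M. B \<subseteq> A}. ennreal (sum c (S \<inter> B))) \<le> ennreal (sum c ?T)"
      using bound by (auto intro!: SUP_least ennreal_leI)
    have "S \<inter> ?T = ?T" by blast
    then show "ennreal (sum c ?T) \<le> (SUP B\<in>{B \<in> sets M. B \<subseteq> A}. ennreal (sum c (S \<inter> B)))"
      using T by (intro SUP_upper2[of ?T]) auto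
  qed
  also have "\<dots> = (\<Sum>x\<in>S \<inter> A. ennreal (max 0 (c x)))"
    by (simp only: positive) simp
  also have "\<dots> = emeasure ?D A"
  proof -
    have "(\<lambda>x. x) \<in> measurable (point_measure S (\<lambda>x. ennreal (max 0 (c x)))) M"
      using assms(2) by auto
    then show ?thesis
      using A finite by (simp add: emeasure_distr space_point_measure emeasure_point_measure_finite2 Int_commute)
  qed
  finally show "emeasure (pos_variation M (atomic_signed_measure S c)) A = emeasure ?D A" .
qed simp

lemma
  fixes f :: "'a \<Rightarrow> real"
  assumes "finite S" "S \<subseteq> space M" "\<And>x. x \<in> S \<Longrightarrow> {x} \<in> sets M" "f \<in> borel_measurable M"
  shows integrable_pos_variation_atomic:
      "integrable (pos_variation M (atomic_signed_measure S c)) f"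
    and integral_pos_variation_atomic:
      "integral\<^sup>L (pos_variation M (atomic_signed_measure S c)) f = (\<Sum>x\<in>S. max 0 (c x) * f x)"
proof -
  have id: "(\<lambda>x. x) \<in> measurable (point_measure S (\<lambda>x. ennreal (max 0 (c x)))) M"
    using assms(2) by auto
  show "integrable (pos_variation M (atomic_signed_measure S c)) f"
    using assms(1) by (simp add: pos_variation_atomic[OF assms(1-3)] integrable_distr_eq[OF id assms(4)]
        integrable_point_measure_finite)
  show "integral\<^sup>L (pos_variation M (atomic_signed_measure S c)) f = (\<Sum>x\<in>S. max 0 (c x) * f x)"
    using assms(1) by (simp add: pos_variation_atomic[OF assms(1-3)] integral_distr[OF id assms(4)]
        lebesgue_integral_point_measure_finite)
qed

lemma
  fixes f :: "'a \<Rightarrow> real"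
  assumes "finite S" "S \<subseteq> space M" "\<And>x. x \<in> S \<Longrightarrow> {x} \<in> sets M" "f \<in> borel_measurable M"
  shows signed_integrable_atomic: "signed_integrable M (atomic_signed_measure S c) f"
    and signed_integral_atomic:
      "signed_integral M (atomic_signed_measure S c) f = (\<Sum>x\<in>S. c x * f x)"
proof -
  \<comment> \<open>Negating the measure negates the weights, so the negative variation is again a
      positive variation of an atomic measure, and \<open>max 0 c - max 0 (- c) = c\<close>.\<close>
  have neg: "neg_variation M (atomic_signed_measure S c)
      = pos_variation M (atomic_signed_measure S (\<lambda>x. - c x))"
    by (simp add: neg_variation_def atomic_signed_measure_def[abs_def] sum_negf)
  show "signed_integrable M (atomic_signed_measure S c) f"
    by (simp add: signed_integrable_def neg integrable_pos_variation_atomic[OF assms])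
  show "signed_integral M (atomic_signed_measure S c) f = (\<Sum>x\<in>S. c x * f x)"
    by (auto simp: signed_integral_def neg integral_pos_variation_atomic[OF assms] max_def
        simp flip: sum_subtractf left_diff_distrib intro!: sum.cong)
qed

theorem theorem3p5:
  fixes F :: "(nat ^ 'd::finite) set" and \<beta> :: "nat ^ 'd \<Rightarrow> real"
  assumes "finite F"
  shows "\<exists>\<mu>. interpolating_measure F \<beta> \<mu>"
proof -
  obtain S c where S: "finite S" and c: "\<And>i. i \<in> F \<Longrightarrow> (\<Sum>x\<in>S. c x * monomial i x) = \<beta> i"
    using ex_finite_interpolating_weights[OF assms] by blast
  have "monomial i \<in> borel_measurable borel" for i :: "nat ^ 'd"
    unfolding monomial_def by (intro borel_measurable_continuous_onI continuous_intros)
  then have "interpolating_measure F \<beta> (atomic_signed_measure S c)"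
    using S c unfolding interpolating_measure_def
    by (simp add: signed_measure_atomic signed_integrable_atomic signed_integral_atomic)
  then show ?thesis by blast
qed

end
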